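(* Let $\mathbf V_{m+1}$ and $\mathbf Z_m$ be generated by $m\geq1$ steps of right-preconditioned rational Krylov applied to the linearization pencil $(\mathbf A,\mathbf B)$ (see context), and let $Q_m$ and $Q_{m+1}$ be matrices with orthonormal columns spanning the column spaces of $$[\,V_m^{[1]}\cdots V_m^{[d]}\ Z_{m-1}^{[1]}\cdots Z_{m-1}^{[d]}\,]\quad\text{and}\quad [\,V_{m+1}^{[1]}\cdots V_{m+1}^{[d]}\ Z_{m}^{[1]}\cdots Z_{m}^{[d]}\,],$$ respectively. Let $p$ be an index associated with the shift $\sigma_m$ as described in the context. Then $$\operatorname{span}\{Q_{m+1}\}=\operatorname{span}\{Q_m,\ z_m^{[p]},\ v_{m+1}^{[1]}\}.$$ If, in addition, there exists $c_B\in\mathbb C^d$ such that $\bar{\mathbf B}:=[B_1\ \cdots\ B_d]=c_B^{T}\otimes I_n$, then $$\operatorname{span}\{Q_{m+1}\}=\operatorname{span}\{Q_m,\ z_m^{[p]}\}.$$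
   Context: Linearization: $A_i,B_i\in\mathbb C^{n\times n}$ ($i=1,\dots,d$), $f(\mu)=[f_1(\mu)\cdots f_d(\mu)]^T\ne0$, $P(\mu)=\sum_{i=1}^d(A_i-\mu B_i)f_i(\mu)$, and $M,N\in\mathbb C^{(d-1)\times d}$ satisfy $(M-\mu N)f(\mu)=0$, $\operatorname{rank}(M-\mu N)=d-1$. The pencil is $$\mathbf A=\begin{bmatrix}A_1\ \cdots\ A_d\\ M\otimes I_n\end{bmatrix},\qquad \mathbf B=\begin{bmatrix}B_1\ \cdots\ B_d\\ N\otimes I_n\end{bmatrix}\in\mathbb C^{dn\times dn}.$$ Right-preconditioned rational Krylov with shifts $\sigma_1,\dots,\sigma_m$ (all $\mathbf A-\sigma_k\mathbf B$ invertible): start from a unit vector $\mathbf v_1\in\mathbb C^{dn}$; in step $k=1,\dots,m$ choose $t_k\in\mathbb C^k$, compute $\mathbf z_k=(\mathbf A-\sigma_k\mathbf B)^{-1}\mathbf V_kt_k$ with $\mathbf V_k=[\mathbf v_1\cdots\mathbf v_k]$, then $\mathbf x_k=\mathbf B\mathbf z_k$, and orthonormalize $\mathbf x_k$ against $\mathbf V_k$ to obtain $\mathbf v_{k+1}$ (no breakdown), i.e. $\mathbf x_k=\mathbf V_{k+1}h_k$ with $h_k\in\mathbb C^{k+1}$ having nonzero last entry and $\mathbf V_{k+1}$ having orthonormal columns. $\mathbf Z_k=[\mathbf z_1\cdots\mathbf z_k]$ ($\mathbf Z_0$ is empty). Blocks: any $\mathbf u\in\mathbb C^{dn}$ is split into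 consecutive blocks $u^{[1]},\dots,u^{[d]}\in\mathbb C^n$; likewise $\mathbf V_k$ is split into $V_k^{[i]}\in\mathbb C^{n\times k}$ and $\mathbf Z_k$ into $Z_k^{[i]}\in\mathbb C^{n\times k}$. $\operatorname{span}\{\cdot\}$ of matrices and vectors denotes the span of all their columns. Index $p$: any $p\in\{1,\dots,d\}$ such that deleting the $p$-th column of $M-\sigma_mN$ leaves an invertible $(d-1)\times(d-1)$ matrix (such $p$ exists by the rank condition). It is the block of $\mathbf z_m$ that is computed by a linear system solve with $P(\sigma_m)$. *)

theory Defs
  imports
    "Jordan_Normal_Form.Matrix"
    "Jordan_Normal_Form.VS_Connect"
    "Jordan_Normal_Form.DL_Rank"
    "Jordan_Normal_Form.Gauss_Jordan_Elimination"
    "Jordan_Normal_Form.Schur_Decomposition"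
begin

(* Indexing: families (coefficients, shifts, iterates, blocks, the index p) are functions on nat
   read at 1, 2, ...; entries inside a matrix or vector of Jordan_Normal_Form are counted from 0. *)

abbreviation cspan :: "nat \<Rightarrow> complex vec set \<Rightarrow> complex vec set" where
  "cspan n S \<equiv> LinearCombinations.module.span class_ring (module_vec TYPE(complex) n) S"

definition colspan :: "complex mat \<Rightarrow> complex vec set" where
  "colspan X = cspan (dim_row X) (set (cols X))"

definition orthonormal_cols :: "complex mat \<Rightarrow> bool" where
  "orthonormal_cols Q \<longleftrightarrow> mat_adjoint Q * Q = 1\<^sub>m (dim_col Q)"

definition hcat :: "nat \<Rightarrow> complex mat list \<Rightarrow> complex mat" where
  "hcat n Xs = mat_of_cols n (concat (map cols Xs))"

definition kron :: "complex mat \<Rightarrow> complex mat \<Rightarrow> complex mat" (infixl "\<otimes>\<^sub>K" 70) where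
  "X \<otimes>\<^sub>K Y = mat (dim_row X * dim_row Y) (dim_col X * dim_col Y)
     (\<lambda>(i, j). X $$ (i div dim_row Y, j div dim_col Y) * Y $$ (i mod dim_row Y, j mod dim_col Y))"

definition delete_col :: "nat \<Rightarrow> complex mat \<Rightarrow> complex mat" where
  "delete_col p X = mat (dim_row X) (dim_col X - 1)
     (\<lambda>(r, c). X $$ (r, if c < p - 1 then c else Suc c))"

definition vec_block :: "nat \<Rightarrow> nat \<Rightarrow> complex vec \<Rightarrow> complex vec" where
  "vec_block n i u = vec n (\<lambda>r. u $ ((i - 1) * n + r))"

definition mat_block :: "nat \<Rightarrow> nat \<Rightarrow> complex mat \<Rightarrow> complex mat" where
  "mat_block n i U = mat n (dim_col U) (\<lambda>(r, c). U $$ ((i - 1) * n + r, c))"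

definition fvec :: "nat \<Rightarrow> (nat \<Rightarrow> complex \<Rightarrow> complex) \<Rightarrow> complex \<Rightarrow> complex vec" where
  "fvec d f \<mu> = vec d (\<lambda>i. f (Suc i) \<mu>)"

definition coeff_row :: "nat \<Rightarrow> nat \<Rightarrow> (nat \<Rightarrow> complex mat) \<Rightarrow> complex mat" where
  "coeff_row n d A = hcat n (map A [1..<Suc d])"

definition pencil_mat ::
  "nat \<Rightarrow> nat \<Rightarrow> (nat \<Rightarrow> complex mat) \<Rightarrow> complex mat \<Rightarrow> complex mat" where
  "pencil_mat n d A M = coeff_row n d A @\<^sub>r (M \<otimes>\<^sub>K 1\<^sub>m n)"

(* \<Omega> is the set of points on which f_1, ..., f_d are considered; it may be UNIV. *)
definition linearization_data ::
  "nat \<Rightarrow> nat \<Rightarrow> complex set \<Rightarrow> (complex \<Rightarrow> complex mat) \<Rightarrow> (nat \<Rightarrow> complex \<Rightarrow> complex) \<Rightarrow>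
   (nat \<Rightarrow> complex mat) \<Rightarrow> (nat \<Rightarrow> complex mat) \<Rightarrow> complex mat \<Rightarrow> complex mat \<Rightarrow> bool" where
  "linearization_data n d \<Omega> P f A B M N \<longleftrightarrow>
     d \<ge> 1 \<and>
     (\<forall>i\<in>{1..d}. A i \<in> carrier_mat n n \<and> B i \<in> carrier_mat n n) \<and>
     M \<in> carrier_mat (d - 1) d \<and> N \<in> carrier_mat (d - 1) d \<and>
     (\<forall>\<mu>\<in>\<Omega>.
        P \<mu> = mat n n (\<lambda>(r, c). \<Sum>i=1..d. (A i - \<mu> \<cdot>\<^sub>m B i) $$ (r, c) * f i \<mu>) \<and>
        fvec d f \<mu> \<noteq> 0\<^sub>v d \<and>
        (M - \<mu> \<cdot>\<^sub>m N) *\<^sub>v fvec d f \<mu> = 0\<^sub>v (d - 1) \<and>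
        vec_space.rank (d - 1) (M - \<mu> \<cdot>\<^sub>m N) = d - 1)"

definition iter_mat :: "nat \<Rightarrow> (nat \<Rightarrow> complex vec) \<Rightarrow> nat \<Rightarrow> complex mat" where
  "iter_mat D v k = mat_of_cols D (map v [1..<Suc k])"

(* Absence of breakdown is the condition h k $ k \<noteq> 0 on the last entry of h k, together with the
   orthonormality of the columns v 1, ..., v (k + 1). *)
definition rational_krylov ::
  "nat \<Rightarrow> complex mat \<Rightarrow> complex mat \<Rightarrow> nat \<Rightarrow> (nat \<Rightarrow> complex) \<Rightarrow> (nat \<Rightarrow> complex vec) \<Rightarrow>
   (nat \<Rightarrow> complex vec) \<Rightarrow> (nat \<Rightarrow> complex vec) \<Rightarrow> (nat \<Rightarrow> complex vec) \<Rightarrow> (nat \<Rightarrow> complex vec) \<Rightarrow> bool"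
where
  "rational_krylov D AA BB m \<sigma> t h x v z \<longleftrightarrow>
     v 1 \<in> carrier_vec D \<and> v 1 \<bullet>c v 1 = 1 \<and>
     (\<forall>k\<in>{1..m}.
        invertible_mat (AA - \<sigma> k \<cdot>\<^sub>m BB) \<and>
        t k \<in> carrier_vec k \<and>
        z k = the (mat_inverse (AA - \<sigma> k \<cdot>\<^sub>m BB)) *\<^sub>v (iter_mat D v k *\<^sub>v t k) \<and>
        x k = BB *\<^sub>v z k \<and>
        v (k + 1) \<in> carrier_vec D \<and>
        h k \<in> carrier_vec (k + 1) \<and> h k $ k \<noteq> 0 \<and>
        x k = iter_mat D v (k + 1) *\<^sub>v h k \<and>
        orthonormal_cols (iter_mat D v (k + 1)))"

(* [V^[1] ... V^[d] Z^[1] ... Z^[d]] *)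
definition block_collection :: "nat \<Rightarrow> nat \<Rightarrow> complex mat \<Rightarrow> complex mat \<Rightarrow> complex mat" where
  "block_collection n d V Z =
     hcat n (map (\<lambda>i. mat_block n i V) [1..<Suc d] @ map (\<lambda>i. mat_block n i Z) [1..<Suc d])"

definition orthonormal_basis_mat :: "nat \<Rightarrow> complex mat \<Rightarrow> complex mat \<Rightarrow> bool" where
  "orthonormal_basis_mat n Q X \<longleftrightarrow>
     dim_row Q = n \<and> orthonormal_cols Q \<and> colspan Q = colspan X"

end

theory Submission
  imports Defs
begin

text \<open>
  The second collection of blocks arises from the first by appending the $2d$ blocks of $v_{m+1}$
  and $z_m$. The claim is that two of them, or even one, already span the same enlargement.

  The lower block rows of the pencil are Kronecker products with the identity: multiplication by
  them combines whole blocks with scalar coefficients. Hence, in rows $2, \ldots, d$, the linear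
  system $(\mathbf A - \sigma_m \mathbf B) z_m = V_m t_m$ says that
  $\sum_j (M - \sigma_m N)_{ij} z_m^{[j]}$ is a block of $V_m t_m$ and so lies in the old space. If
  the columns of $M - \sigma_m N$ other than the $p$-th form an invertible matrix, this system can
  be solved for the blocks other than $z_m^{[p]}$. So all blocks of $z_m$ lie in the space
  $\mathcal U$ spanned by the old blocks and $z_m^{[p]}$
  (\<open>blocks_in_cspan_if_delete_col_invertible\<close>).

  Since there is no breakdown, $v_{m+1}$ is a linear combination of $v_1, \ldots, v_m$ and
  $x_m = \mathbf B z_m$. The blocks $2, \ldots, d$ of $x_m$ are combinations of the blocks of
  $z_m$ with coefficients from $N$, so they lie in $\mathcal U$, and the same follows for
  $v_{m+1}$. Only the first block remains, because $[B_1 \cdots B_d]$ multiplies the blocks of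
  $z_m$ by genuine matrices. If $[B_1 \cdots B_d] = c_B^T \otimes I$, these multiplications are
  scalar as well, and the first block lies in $\mathcal U$ too.
\<close>

section \<open>Spans of complex vectors\<close>

text \<open>
  All linear combinations below are written entrywise, with \<^const>\<open>vec\<close> and a scalar sum. This is
  the form in which matrix-vector products deliver them.
\<close>

lemma cspan_vec_sum:
  assumes S: "S \<subseteq> carrier_vec n"
    and u: "\<And>j. j \<in> J \<Longrightarrow> u j \<in> cspan n S"
  shows "vec n (\<lambda>r. \<Sum>j\<in>J. c j * u j $ r) \<in> cspan n S"
proof -
  interpret vec_space "TYPE(complex)" n .
  show ?thesis using u
  proof (induction J rule: infinite_finite_induct)
    case (infinite J)
    then have "vec n (\<lambda>r. \<Sum>j\<in>J. c j * u j $ r) = 0\<^sub>v n" by auto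
    moreover have "0\<^sub>v n \<in> cspan n S" using sumlist_in_span[OF S, of "[]"] by simp
    ultimately show ?case by (simp only:)
  next
    case empty
    have "vec n (\<lambda>r. \<Sum>j\<in>{}. c j * u j $ r) = 0\<^sub>v n" by auto
    moreover have "0\<^sub>v n \<in> cspan n S" using sumlist_in_span[OF S, of "[]"] by simp
    ultimately show ?case by (simp only:)
  next
    case (insert a J)
    have ua: "u a \<in> carrier_vec n" using insert.prems S span_closed by auto
    have "vec n (\<lambda>r. \<Sum>j\<in>insert a J. c j * u j $ r) =
        c a \<cdot>\<^sub>v u a + vec n (\<lambda>r. \<Sum>j\<in>J. c j * u j $ r)"
      using insert.hyps ua by (intro eq_vecI) auto
    moreover have "c a \<cdot>\<^sub>v u a \<in> cspan n S"
      using insert.prems smult_in_span[OF S] by auto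
    moreover have "vec n (\<lambda>r. \<Sum>j\<in>J. c j * u j $ r) \<in> cspan n S"
      using insert by auto
    ultimately show ?case using span_add1[OF S] by simp
  qed
qed

lemma cspan_superset: "S \<subseteq> carrier_vec n \<Longrightarrow> u \<in> S \<Longrightarrow> u \<in> cspan n S"
proof -
  interpret vec_space "TYPE(complex)" n .
  show "S \<subseteq> carrier_vec n \<Longrightarrow> u \<in> S \<Longrightarrow> u \<in> cspan n S"
    using in_own_span by auto
qed

lemma cspan_minimal:
  "S \<subseteq> carrier_vec n \<Longrightarrow> T \<subseteq> cspan n S \<Longrightarrow> cspan n T \<subseteq> cspan n S"
proof -
  interpret vec_space "TYPE(complex)" n .
  show "S \<subseteq> carrier_vec n \<Longrightarrow> T \<subseteq> cspan n S \<Longrightarrow> cspan n T \<subseteq> cspan n S"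
    by (rule span_subsetI)
qed

lemma cspan_mono:
  "T \<subseteq> carrier_vec n \<Longrightarrow> S \<subseteq> T \<Longrightarrow> cspan n S \<subseteq> cspan n T"
  by (rule cspan_minimal) (auto intro: cspan_superset)

lemma cspan_vec_axpy:
  assumes S: "S \<subseteq> carrier_vec n" and u: "u \<in> cspan n S" and w: "w \<in> cspan n S"
  shows "vec n (\<lambda>r. a * u $ r + b * w $ r) \<in> cspan n S"
proof -
  have "vec n (\<lambda>r. \<Sum>j\<in>{0::nat, 1}. (if j = 0 then a else b) * (if j = 0 then u else w) $ r)
      \<in> cspan n S"
    by (rule cspan_vec_sum[OF S]) (use u w in auto)
  then show ?thesis by simp
qed

text \<open>This lets the columns of an orthonormal basis be replaced by the blocks that they span.\<close>

lemma cspan_Un_cong: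
  assumes eq: "cspan n S = cspan n S'" and S: "S \<subseteq> carrier_vec n" and S': "S' \<subseteq> carrier_vec n"
    and T: "T \<subseteq> carrier_vec n"
  shows "cspan n (S \<union> T) = cspan n (S' \<union> T)"
proof -
  have "cspan n (X \<union> T) \<subseteq> cspan n (Y \<union> T)"
    if "cspan n X = cspan n Y" "X \<subseteq> carrier_vec n" "Y \<subseteq> carrier_vec n" for X Y
  proof (rule cspan_minimal)
    show "Y \<union> T \<subseteq> carrier_vec n" using that T by auto
    then show "X \<union> T \<subseteq> cspan n (Y \<union> T)"
      using that cspan_superset[of X n] cspan_mono[of "Y \<union> T" n Y] cspan_superset[of "Y \<union> T" n]
      by blast
  qed
  then show ?thesis using assms by blast
qed

section \<open>Block structure of the pencil\<close>

lemma vec_block_carrier [simp]: "vec_block n i u \<in> carrier_vec n"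
  by (simp add: vec_block_def)

lemma block_index_less:
  fixes i d n r :: nat
  assumes "i < d" "r < n"
  shows "i * n + r < d * n"
proof -
  have "i * n + r < Suc i * n" using assms by simp
  also have "\<dots> \<le> d * n" using assms by (intro mult_right_mono) auto
  finally show ?thesis .
qed

lemma sum_blocks:
  fixes g :: "nat \<Rightarrow> complex"
  shows "(\<Sum>q<d * n. g q) = (\<Sum>j<d. \<Sum>s<n. g (j * n + s))"
proof -
  have "(\<Sum>j<d. sum g {j * n..<j * n + n}) = (\<Sum>j<d. \<Sum>s<n. g (j * n + s))"
  proof (rule sum.cong)
    fix j
    show "sum g {j * n..<j * n + n} = (\<Sum>s<n. g (j * n + s))"
      using sum.shift_bounds_nat_ivl[of g 0 "j * n" n]
      by (simp add: atLeast0LessThan add.commute)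
  qed simp
  then show ?thesis by (simp add: sum.nat_group)
qed

text \<open>
  Entry $(in + r, q)$ of $G \otimes I_n$ vanishes unless $q \equiv r$ modulo $n$. So block $i$ of the
  product, with blocks counted from 0, is a combination of the blocks of \<^term>\<open>u\<close> with row $i$ of \<^term>\<open>G\<close> as scalar
  coefficients.
\<close>

lemma kron_one_mult_vec_index:
  assumes i: "i < dim_row G" and r: "r < n" and u: "u \<in> carrier_vec (dim_col G * n)"
  shows "((G \<otimes>\<^sub>K 1\<^sub>m n) *\<^sub>v u) $ (i * n + r) =
    (\<Sum>j<dim_col G. G $$ (i, j) * vec_block n (Suc j) u $ r)"
proof -
  have "((G \<otimes>\<^sub>K 1\<^sub>m n) *\<^sub>v u) $ (i * n + r) =
      (\<Sum>q<dim_col G * n. G $$ (i, q div n) * (1\<^sub>m n) $$ (r, q mod n) * u $ q)"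
    using assms block_index_less[OF i r]
    by (auto simp: kron_def scalar_prod_def atLeast0LessThan)
  also have "\<dots> = (\<Sum>j<dim_col G. \<Sum>s<n. G $$ (i, j) * (if s = r then u $ (j * n + s) else 0))"
    unfolding sum_blocks using r by (intro sum.cong) auto
  also have "\<dots> = (\<Sum>j<dim_col G. G $$ (i, j) * u $ (j * n + r))"
    using r by (simp add: sum_distrib_left[symmetric])
  finally show ?thesis using r by (simp add: vec_block_def)
qed

lemma coeff_row_carrier:
  assumes "A \<in> {1..d} \<rightarrow> carrier_mat n n"
  shows "coeff_row n d A \<in> carrier_mat n (d * n)"
proof -
  have "length (concat (map cols (map A [1..<Suc d]))) = d * n" using assms
  proof (induction d)
    case (Suc d)
    have "A (Suc d) \<in> carrier_mat n n" "A \<in> {1..d} \<rightarrow> carrier_mat n n"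
      using Suc.prems by auto
    moreover have "map A [1..<Suc (Suc d)] = map A [1..<Suc d] @ [A (Suc d)]" by simp
    ultimately show ?case using Suc.IH by (simp del: upt_Suc)
  qed simp
  then show ?thesis unfolding coeff_row_def hcat_def
    by (metis mat_of_cols_carrier(1))
qed

lemma pencil_mat_carrier:
  assumes "A \<in> {1..d} \<rightarrow> carrier_mat n n" and "M \<in> carrier_mat (d - 1) d" and "d \<ge> 1"
  shows "pencil_mat n d A M \<in> carrier_mat (d * n) (d * n)"
proof -
  have "pencil_mat n d A M \<in> carrier_mat (n + (d - 1) * n) (d * n)"
    unfolding pencil_mat_def
    using assms by (intro carrier_append_rows coeff_row_carrier) (auto simp: kron_def)
  moreover have "n + (d - 1) * n = d * n" using assms(3) by (cases d) auto
  ultimately show ?thesis by simp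
qed

lemma pencil_mat_mult_vec:
  assumes "A \<in> {1..d} \<rightarrow> carrier_mat n n" and "M \<in> carrier_mat (d - 1) d"
    and "u \<in> carrier_vec (d * n)"
  shows "pencil_mat n d A M *\<^sub>v u = (coeff_row n d A *\<^sub>v u) @\<^sub>v ((M \<otimes>\<^sub>K 1\<^sub>m n) *\<^sub>v u)"
  unfolding pencil_mat_def
  by (rule mat_mult_append[OF coeff_row_carrier[OF assms(1)] _ assms(3)])
     (use assms(2) in \<open>auto simp: kron_def\<close>)

lemma vec_block_pencil_mult_first:
  assumes "A \<in> {1..d} \<rightarrow> carrier_mat n n" and "M \<in> carrier_mat (d - 1) d"
    and "u \<in> carrier_vec (d * n)" and "r < n"
  shows "vec_block n 1 (pencil_mat n d A M *\<^sub>v u) $ r = (coeff_row n d A *\<^sub>v u) $ r"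
proof -
  have "coeff_row n d A \<in> carrier_mat n (d * n)" using assms(1) by (rule coeff_row_carrier)
  then show ?thesis unfolding pencil_mat_mult_vec[OF assms(1-3)]
    using assms(4) by (simp add: vec_block_def)
qed

text \<open>
  Below the first block row the pencil acts through \<^term>\<open>M\<close> alone. The offset 2 arises because
  blocks are numbered from 1 and the first one belongs to the coefficient matrices.
\<close>

lemma vec_block_pencil_mult_lower:
  assumes "A \<in> {1..d} \<rightarrow> carrier_mat n n" and M: "M \<in> carrier_mat (d - 1) d"
    and u: "u \<in> carrier_vec (d * n)" and i: "i < d - 1" and r: "r < n"
  shows "vec_block n (i + 2) (pencil_mat n d A M *\<^sub>v u) $ r =
    (\<Sum>j<d. M $$ (i, j) * vec_block n (Suc j) u $ r)"
proof -
  have "((M \<otimes>\<^sub>K 1\<^sub>m n) *\<^sub>v u) $ (i * n + r) = (\<Sum>j<d. M $$ (i, j) * vec_block n (Suc j) u $ r)"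
    using kron_one_mult_vec_index[of i M r n u] assms by auto
  moreover have "dim_vec ((M \<otimes>\<^sub>K 1\<^sub>m n) *\<^sub>v u) = (d - 1) * n"
    using M by (simp add: kron_def)
  moreover have "coeff_row n d A \<in> carrier_mat n (d * n)"
    using assms(1) by (rule coeff_row_carrier)
  ultimately show ?thesis
    unfolding pencil_mat_mult_vec[OF assms(1-3)]
    using r block_index_less[OF i r] by (simp add: vec_block_def)
qed

section \<open>Recovering all blocks from one\<close>

text \<open>
  Moving the \<^term>\<open>p\<close>-th summand of each combination to the other side leaves a square system with
  an invertible scalar matrix for the remaining \<^term>\<open>y j\<close>, whose right-hand sides lie in the
  span. Its inverse expresses every \<^term>\<open>y j\<close> through these right-hand sides.
\<close>

lemma blocks_in_cspan_if_delete_col_invertible: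
  assumes S: "S \<subseteq> carrier_vec n"
    and K: "K \<in> carrier_mat (d - 1) d" and p: "p \<in> {1..d}"
    and inv: "invertible_mat (delete_col p K)"
    and y: "\<And>j. j \<in> {1..d} \<Longrightarrow> y j \<in> carrier_vec n"
    and comb: "\<And>i. i < d - 1 \<Longrightarrow> vec n (\<lambda>r. \<Sum>j<d. K $$ (i, j) * y (Suc j) $ r) \<in> cspan n S"
    and yp: "y p \<in> cspan n S"
    and j: "j \<in> {1..d}"
  shows "y j \<in> cspan n S"
proof (cases "j = p")
  case False
  define G where "G = delete_col p K"
  \<comment> \<open>Column \<open>k\<close> of the reduced matrix is column \<open>q k\<close> of \<open>K\<close>, counted from 0.\<close>
  define q where "q k = (if k < p - 1 then k else Suc k)" for k
  have G: "G \<in> carrier_mat (d - 1) (d - 1)"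
    using K by (auto simp: G_def delete_col_def)
  obtain G' where "inverts_mat G G'" "inverts_mat G' G"
    using inv unfolding invertible_mat_def G_def by blast
  then have G'G: "G' * G = 1\<^sub>m (d - 1)" and G': "G' \<in> carrier_mat (d - 1) (d - 1)"
    unfolding inverts_mat_def using G
    by (metis carrier_matD carrier_matI index_mult_mat(2,3) index_one_mat(2,3))+
  have Gq: "G $$ (i, k) = K $$ (i, q k)" if "i < d - 1" "k < d - 1" for i k
    using that K by (simp add: G_def delete_col_def q_def)
  have q_bij: "bij_betw q {..<d - 1} ({..<d} - {p - 1})"
  proof (rule bij_betwI[where g = "\<lambda>l. if l < p - 1 then l else l - 1"])
  qed (use p in \<open>auto simp: q_def split: if_splits\<close>)
  \<comment> \<open>The right-hand sides of the reduced system.\<close>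
  define b where "b i = vec n (\<lambda>r. \<Sum>k<d - 1. G $$ (i, k) * y (Suc (q k)) $ r)" for i
  have b: "b i \<in> cspan n S" if i: "i < d - 1" for i
  proof -
    let ?c = "vec n (\<lambda>r. \<Sum>j<d. K $$ (i, j) * y (Suc j) $ r)"
    have "(\<Sum>k<d - 1. G $$ (i, k) * y (Suc (q k)) $ r) =
        (\<Sum>j<d. K $$ (i, j) * y (Suc j) $ r) - K $$ (i, p - 1) * y p $ r" for r
    proof -
      have "(\<Sum>k<d - 1. G $$ (i, k) * y (Suc (q k)) $ r) =
          (\<Sum>k<d - 1. K $$ (i, q k) * y (Suc (q k)) $ r)"
        using i by (intro sum.cong) (auto simp: Gq)
      also have "\<dots> = (\<Sum>j\<in>{..<d} - {p - 1}. K $$ (i, j) * y (Suc j) $ r)"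
        by (rule sum.reindex_bij_betw[OF q_bij])
      finally have "(\<Sum>k<d - 1. G $$ (i, k) * y (Suc (q k)) $ r) =
          (\<Sum>j\<in>{..<d} - {p - 1}. K $$ (i, j) * y (Suc j) $ r)" .
      moreover have "p - 1 \<in> {..<d}" "Suc (p - 1) = p" using p by auto
      ultimately show ?thesis by (simp only: sum_diff1 finite_lessThan if_True)
    qed
    then have "b i = vec n (\<lambda>r. 1 * ?c $ r + (- K $$ (i, p - 1)) * y p $ r)"
      unfolding b_def by (intro eq_vecI) auto
    then show ?thesis
      using cspan_vec_axpy[OF S comb[OF i] yp, of 1 "- K $$ (i, p - 1)"] by (simp only:)
  qed
  \<comment> \<open>Row \<open>l\<close> of the inverse solves for \<open>y j\<close>.\<close>
  have "j - 1 \<in> {..<d} - {p - 1}" using j p False by auto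
  then obtain l where l: "l < d - 1" "q l = j - 1"
    using q_bij unfolding bij_betw_def by (metis imageE lessThan_iff)
  have "y j = vec n (\<lambda>r. \<Sum>i<d - 1. G' $$ (l, i) * b i $ r)"
  proof (intro eq_vecI)
    fix r assume "r < dim_vec (vec n (\<lambda>r. \<Sum>i<d - 1. G' $$ (l, i) * b i $ r))"
    then have r: "r < n" by simp
    have "(\<Sum>i<d - 1. G' $$ (l, i) * b i $ r) =
        (\<Sum>i<d - 1. \<Sum>k<d - 1. G' $$ (l, i) * G $$ (i, k) * y (Suc (q k)) $ r)"
      using r by (simp add: b_def sum_distrib_left mult.assoc)
    also have "\<dots> = (\<Sum>k<d - 1. (\<Sum>i<d - 1. G' $$ (l, i) * G $$ (i, k)) * y (Suc (q k)) $ r)"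
      by (subst sum.swap) (simp add: sum_distrib_right)
    also have "\<dots> = (\<Sum>k<d - 1. (G' * G) $$ (l, k) * y (Suc (q k)) $ r)"
      using G G' l by (intro sum.cong) (auto simp: scalar_prod_def atLeast0LessThan)
    also have "\<dots> = (\<Sum>k<d - 1. if k = l then y (Suc (q k)) $ r else 0)"
      unfolding G'G using l by (intro sum.cong) auto
    also have "\<dots> = y j $ r" using l j by simp
    finally show "y j $ r = vec n (\<lambda>r. \<Sum>i<d - 1. G' $$ (l, i) * b i $ r) $ r"
      using r by simp
  qed (use y[OF j] in auto)
  moreover have "\<dots> \<in> cspan n S"
    by (rule cspan_vec_sum[OF S]) (use b in auto)
  ultimately show ?thesis by simp
qed (use yp in simp)

section \<open>Collections of blocks and Krylov iterates\<close>

lemma col_mat_block: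
  assumes "c < dim_col U" "i \<in> {1..d}" "dim_row U = d * n"
  shows "col (mat_block n i U) c = vec_block n i (col U c)"
proof (intro eq_vecI)
  fix r assume "r < dim_vec (vec_block n i (col U c))"
  then have "r < n" by (simp add: vec_block_def)
  then have "(i - 1) * n + r < d * n" using assms by (intro block_index_less) auto
  then show "col (mat_block n i U) c $ r = vec_block n i (col U c) $ r"
    using assms \<open>r < n\<close> by (simp add: mat_block_def vec_block_def)
qed (auto simp: mat_block_def vec_block_def)

lemma set_cols_mat_block_iter_mat:
  assumes v: "\<And>k. k \<in> {1..m} \<Longrightarrow> v k \<in> carrier_vec (d * n)" and i: "i \<in> {1..d}"
  shows "set (cols (mat_block n i (iter_mat (d * n) v m))) = (\<lambda>k. vec_block n i (v k)) ` {1..m}"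
proof -
  let ?U = "iter_mat (d * n) v m"
  have U: "dim_row ?U = d * n" "dim_col ?U = m" by (auto simp: iter_mat_def)
  have "set (cols (mat_block n i ?U)) = col (mat_block n i ?U) ` {..<m}"
    using U by (auto simp: cols_def mat_block_def)
  also have "\<dots> = (\<lambda>c. vec_block n i (v (Suc c))) ` {..<m}"
  proof (rule image_cong)
    fix c assume "c \<in> {..<m}"
    moreover from this have "v (Suc c) \<in> carrier_vec (d * n)" using v by auto
    moreover from calculation have "col ?U c = v (Suc c)"
      unfolding iter_mat_def by (subst col_mat_of_cols) (auto simp del: upt_Suc)
    ultimately show "col (mat_block n i ?U) c = vec_block n i (v (Suc c))"
      using U(2) col_mat_block[OF _ i U(1), of c] by simp
  qed simp
  also have "\<dots> = (\<lambda>k. vec_block n i (v k)) ` Suc ` {..<m}" by (simp add: image_image)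
  finally show ?thesis by (simp add: image_Suc_lessThan)
qed

lemma colspan_block_collection:
  assumes v: "\<And>k. k \<in> {1..m} \<Longrightarrow> v k \<in> carrier_vec (d * n)"
    and z: "\<And>k. k \<in> {1..l} \<Longrightarrow> z k \<in> carrier_vec (d * n)"
  shows "colspan (block_collection n d (iter_mat (d * n) v m) (iter_mat (d * n) z l)) =
    cspan n ({vec_block n i (v k) |i k. i \<in> {1..d} \<and> k \<in> {1..m}} \<union>
             {vec_block n i (z k) |i k. i \<in> {1..d} \<and> k \<in> {1..l}})"
proof -
  let ?V = "iter_mat (d * n) v m" and ?Z = "iter_mat (d * n) z l"
  let ?c = "concat (map cols (map (\<lambda>i. mat_block n i ?V) [1..<Suc d] @
      map (\<lambda>i. mat_block n i ?Z) [1..<Suc d]))"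
  have c: "set ?c = {vec_block n i (v k) |i k. i \<in> {1..d} \<and> k \<in> {1..m}} \<union>
             {vec_block n i (z k) |i k. i \<in> {1..d} \<and> k \<in> {1..l}}"
  proof -
    have "set ?c = (\<Union>i\<in>{1..d}. set (cols (mat_block n i ?V))) \<union>
        (\<Union>i\<in>{1..d}. set (cols (mat_block n i ?Z)))"
      by (auto simp del: upt_Suc simp: atLeastLessThanSuc_atLeastAtMost)
    also have "\<dots> = (\<Union>i\<in>{1..d}. (\<lambda>k. vec_block n i (v k)) ` {1..m}) \<union>
        (\<Union>i\<in>{1..d}. (\<lambda>k. vec_block n i (z k)) ` {1..l})"
      using set_cols_mat_block_iter_mat[of m v d n] set_cols_mat_block_iter_mat[of l z d n] v z
      by (intro arg_cong2[where f = "(\<union>)"] SUP_cong) auto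
    finally have eq: "set ?c = \<dots>" .
    show ?thesis unfolding eq by blast
  qed
  then have "set ?c \<subseteq> carrier_vec n" by auto
  then have "cols (block_collection n d ?V ?Z) = ?c"
    unfolding block_collection_def hcat_def by (rule cols_mat_of_cols)
  then show ?thesis unfolding colspan_def using c
    by (simp add: block_collection_def hcat_def)
qed

lemma iter_mat_mult_vec_index:
  assumes "q < D" "t \<in> carrier_vec k"
  shows "(iter_mat D v k *\<^sub>v t) $ q = (\<Sum>c<k. t $ c * v (Suc c) $ q)"
  using assms
  by (auto simp: iter_mat_def scalar_prod_def mat_of_cols_index atLeast0LessThan mult.commute
      simp del: upt_Suc intro!: sum.cong)

lemma mat_inverse_mult_vec:
  fixes C :: "complex mat"
  assumes C: "C \<in> carrier_mat D D" and inv: "invertible_mat C" and w: "w \<in> carrier_vec D"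
  shows "the (mat_inverse C) *\<^sub>v w \<in> carrier_vec D" and "C *\<^sub>v (the (mat_inverse C) *\<^sub>v w) = w"
proof -
  obtain C' where "inverts_mat C C'" "inverts_mat C' C"
    using inv unfolding invertible_mat_def by blast
  then have "C * C' = 1\<^sub>m D" "C' * C = 1\<^sub>m D" "C' \<in> carrier_mat D D"
    unfolding inverts_mat_def using C
    by (metis carrier_matD carrier_matI index_mult_mat(2,3) index_one_mat(2,3))+
  then have "C \<in> Units (ring_mat TYPE(complex) D ())"
    using C by (auto simp: Units_def ring_mat_def)
  then obtain X where X: "mat_inverse C = Some X"
    using mat_inverse(1)[OF C, where b = "()"] by (cases "mat_inverse C") auto
  have CX: "C * X = 1\<^sub>m D" and Xc: "X \<in> carrier_mat D D" using mat_inverse(2)[OF C X] by auto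
  show "the (mat_inverse C) *\<^sub>v w \<in> carrier_vec D" using X Xc w by simp
  have "C *\<^sub>v (X *\<^sub>v w) = (C * X) *\<^sub>v w" using C Xc w by simp
  then show "C *\<^sub>v (the (mat_inverse C) *\<^sub>v w) = w" using X CX w by simp
qed


lemma vec_block_iter_mat_mult:
  assumes i: "i \<in> {1..d}" and t: "t \<in> carrier_vec k"
  shows "vec_block n i (iter_mat (d * n) v k *\<^sub>v t) =
    vec n (\<lambda>r. \<Sum>c<k. t $ c * vec_block n i (v (Suc c)) $ r)"
proof (rule eq_vecI)
  fix r assume "r < dim_vec (vec n (\<lambda>r. \<Sum>c<k. t $ c * vec_block n i (v (Suc c)) $ r))"
  then have r: "r < n" by simp
  then have "(i - 1) * n + r < d * n" using i by (intro block_index_less) auto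
  then show "vec_block n i (iter_mat (d * n) v k *\<^sub>v t) $ r =
      vec n (\<lambda>r. \<Sum>c<k. t $ c * vec_block n i (v (Suc c)) $ r) $ r"
    using r iter_mat_mult_vec_index[OF _ t] by (simp add: vec_block_def)
qed (simp add: vec_block_def)

section \<open>One step of right-preconditioned rational Krylov\<close>

theorem theorem3p6:
  fixes n d m p :: nat
    and \<Omega> :: "complex set"
    and P :: "complex \<Rightarrow> complex mat"
    and f :: "nat \<Rightarrow> complex \<Rightarrow> complex"
    and A B :: "nat \<Rightarrow> complex mat"
    and M N :: "complex mat"
    and \<sigma> :: "nat \<Rightarrow> complex"
    and t h x v z :: "nat \<Rightarrow> complex vec"
    and Q_m Q_m1 :: "complex mat"
  assumes "linearization_data n d \<Omega> P f A B M N"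
    and "m \<ge> 1"
    and "\<And>k. k \<in> {1..m} \<Longrightarrow> \<sigma> k \<in> \<Omega>"
    and "rational_krylov (d * n) (pencil_mat n d A M) (pencil_mat n d B N) m \<sigma> t h x v z"
    and "orthonormal_basis_mat n Q_m
           (block_collection n d (iter_mat (d * n) v m) (iter_mat (d * n) z (m - 1)))"
    and "orthonormal_basis_mat n Q_m1
           (block_collection n d (iter_mat (d * n) v (m + 1)) (iter_mat (d * n) z m))"
    and "p \<in> {1..d}"
    and "invertible_mat (delete_col p (M - \<sigma> m \<cdot>\<^sub>m N))"
  shows "colspan Q_m1 =
           cspan n (set (cols Q_m) \<union> {vec_block n p (z m), vec_block n 1 (v (m + 1))}) \<and>
         ((\<exists>c_B \<in> carrier_vec d. coeff_row n d B = mat_of_rows d [c_B] \<otimes>\<^sub>K 1\<^sub>m n) \<longrightarrow>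
           colspan Q_m1 = cspan n (set (cols Q_m) \<union> {vec_block n p (z m)}))"
proof -
  let ?D = "d * n" and ?AA = "pencil_mat n d A M" and ?BB = "pencil_mat n d B N"
  let ?K = "M - \<sigma> m \<cdot>\<^sub>m N"
  have d: "d \<ge> 1" and A: "A \<in> {1..d} \<rightarrow> carrier_mat n n"
    and B: "B \<in> {1..d} \<rightarrow> carrier_mat n n"
    and M: "M \<in> carrier_mat (d - 1) d" and N: "N \<in> carrier_mat (d - 1) d"
    using assms(1) unfolding linearization_data_def by auto
  have AA: "?AA \<in> carrier_mat ?D ?D" by (rule pencil_mat_carrier[OF A M d])
  have BB: "?BB \<in> carrier_mat ?D ?D" by (rule pencil_mat_carrier[OF B N d])
  have v1: "v 1 \<in> carrier_vec ?D"
    and step: "\<And>k. k \<in> {1..m} \<Longrightarrow> invertible_mat (?AA - \<sigma> k \<cdot>\<^sub>m ?BB) \<and> t k \<in> carrier_vec k \<and>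
        z k = the (mat_inverse (?AA - \<sigma> k \<cdot>\<^sub>m ?BB)) *\<^sub>v (iter_mat ?D v k *\<^sub>v t k) \<and>
        x k = ?BB *\<^sub>v z k \<and> v (k + 1) \<in> carrier_vec ?D \<and>
        h k \<in> carrier_vec (k + 1) \<and> h k $ k \<noteq> 0 \<and> x k = iter_mat ?D v (k + 1) *\<^sub>v h k"
    using assms(4) unfolding rational_krylov_def by blast+
  have v: "v k \<in> carrier_vec ?D" if "k \<in> {1..m + 1}" for k
  proof (cases "k = 1")
    case False
    then have "k - 1 \<in> {1..m}" "k - 1 + 1 = k" using that by auto
    then show ?thesis using step[of "k - 1"] by simp
  qed (use v1 in simp)
  have w: "iter_mat ?D v k *\<^sub>v t k \<in> carrier_vec ?D" for k
    unfolding carrier_vec_def by (simp add: iter_mat_def)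
  have z: "z k \<in> carrier_vec ?D"
    and solve: "(?AA - \<sigma> k \<cdot>\<^sub>m ?BB) *\<^sub>v z k = iter_mat ?D v k *\<^sub>v t k" if k: "k \<in> {1..m}" for k
  proof -
    have C: "?AA - \<sigma> k \<cdot>\<^sub>m ?BB \<in> carrier_mat ?D ?D" using AA BB by auto
    have inv: "invertible_mat (?AA - \<sigma> k \<cdot>\<^sub>m ?BB)"
      and zk: "z k = the (mat_inverse (?AA - \<sigma> k \<cdot>\<^sub>m ?BB)) *\<^sub>v (iter_mat ?D v k *\<^sub>v t k)"
      using step[OF k] by auto
    show "z k \<in> carrier_vec ?D"
      and "(?AA - \<sigma> k \<cdot>\<^sub>m ?BB) *\<^sub>v z k = iter_mat ?D v k *\<^sub>v t k"
      using mat_inverse_mult_vec[OF C inv w] unfolding zk by simp_all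
  qed
  have m: "m \<in> {1..m}" using assms(2) by simp
  note zm = z[OF m]
  define S where "S = {vec_block n i (v k) |i k. i \<in> {1..d} \<and> k \<in> {1..m}} \<union>
      {vec_block n i (z k) |i k. i \<in> {1..d} \<and> k \<in> {1..m - 1}}"
  define S' where "S' = {vec_block n i (v k) |i k. i \<in> {1..d} \<and> k \<in> {1..m + 1}} \<union>
      {vec_block n i (z k) |i k. i \<in> {1..d} \<and> k \<in> {1..m}}"
  let ?zp = "vec_block n p (z m)" and ?v1 = "vec_block n 1 (v (m + 1))"
  \<comment> \<open>\<open>S\<close> and \<open>S'\<close> are the old and the new blocks; everything except \<open>?v1\<close> is shown to lie in the span
    of \<open>U\<close>.\<close>
  define U where "U = insert ?zp S"
  have S: "S \<subseteq> carrier_vec n" and S': "S' \<subseteq> carrier_vec n" and U: "U \<subseteq> carrier_vec n"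
    unfolding S_def S'_def U_def by auto
  have span_Q': "colspan Q_m1 = cspan n S'"
    using assms(6) colspan_block_collection[OF v z]
    unfolding orthonormal_basis_mat_def S'_def by simp
  have "v k \<in> carrier_vec ?D" if "k \<in> {1..m}" for k using that by (intro v) auto
  moreover have "z k \<in> carrier_vec ?D" if "k \<in> {1..m - 1}" for k using that by (intro z) auto
  ultimately have "colspan (block_collection n d (iter_mat ?D v m) (iter_mat ?D z (m - 1))) =
      cspan n S"
    unfolding S_def by (rule colspan_block_collection)
  then have "colspan Q_m = cspan n S"
    using assms(5) unfolding orthonormal_basis_mat_def by simp
  then have span_Q: "cspan n (set (cols Q_m)) = cspan n S" and Q: "set (cols Q_m) \<subseteq> carrier_vec n"
    using assms(5) cols_dim[of Q_m] unfolding orthonormal_basis_mat_def colspan_def by auto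

  have v_old: "vec_block n i (v (Suc c)) \<in> cspan n U" if "i \<in> {1..d}" "c < m" for i c
  proof (rule cspan_superset[OF U])
    have "vec_block n i (v (Suc c)) \<in> {vec_block n i (v k) |i k. i \<in> {1..d} \<and> k \<in> {1..m}}"
      by (intro CollectI exI[of _ i] exI[of _ "Suc c"]) (use that in auto)
    then show "vec_block n i (v (Suc c)) \<in> U" unfolding U_def S_def by blast
  qed
  have zp: "?zp \<in> cspan n U" by (rule cspan_superset[OF U]) (simp add: U_def)
  \<comment> \<open>The lower block rows of the linear system for \<open>z m\<close>, whose right-hand side combines old blocks.\<close>
  have row: "vec n (\<lambda>r. \<Sum>j<d. ?K $$ (i, j) * vec_block n (Suc j) (z m) $ r) \<in> cspan n U"
    if i: "i < d - 1" for i
  proof -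
    have i2: "i + 2 \<in> {1..d}" using i by auto
    have Cz: "(?AA - \<sigma> m \<cdot>\<^sub>m ?BB) *\<^sub>v z m = ?AA *\<^sub>v z m - \<sigma> m \<cdot>\<^sub>v (?BB *\<^sub>v z m)"
      using AA BB zm by (auto simp: minus_mult_distrib_mat_vec)
    have "vec n (\<lambda>r. \<Sum>j<d. ?K $$ (i, j) * vec_block n (Suc j) (z m) $ r) =
        vec_block n (i + 2) (iter_mat ?D v m *\<^sub>v t m)"
    proof (rule eq_vecI)
      fix r assume "r < dim_vec (vec_block n (i + 2) (iter_mat ?D v m *\<^sub>v t m))"
      then have r: "r < n" by (simp add: vec_block_def)
      have "(i + 1) * n + r < ?D" using i r by (intro block_index_less) auto
      then have "vec_block n (i + 2) (iter_mat ?D v m *\<^sub>v t m) $ r =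
          vec_block n (i + 2) (?AA *\<^sub>v z m) $ r - \<sigma> m * vec_block n (i + 2) (?BB *\<^sub>v z m) $ r"
        unfolding solve[OF m, symmetric] Cz using r AA BB zm by (simp add: vec_block_def)
      also have "\<dots> = (\<Sum>j<d. ?K $$ (i, j) * vec_block n (Suc j) (z m) $ r)"
        unfolding vec_block_pencil_mult_lower[OF A M zm i r]
          vec_block_pencil_mult_lower[OF B N zm i r]
        using M N i by (simp add: sum_distrib_left sum_subtractf[symmetric] algebra_simps)
      finally show "vec n (\<lambda>r. \<Sum>j<d. ?K $$ (i, j) * vec_block n (Suc j) (z m) $ r) $ r =
          vec_block n (i + 2) (iter_mat ?D v m *\<^sub>v t m) $ r" using r by simp
    qed (simp add: vec_block_def)
    also have "\<dots> = vec n (\<lambda>r. \<Sum>c<m. t m $ c * vec_block n (i + 2) (v (Suc c)) $ r)"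
      using step[OF m] by (intro vec_block_iter_mat_mult[OF i2]) auto
    also have "\<dots> \<in> cspan n U"
      using v_old[OF i2] by (intro cspan_vec_sum[OF U]) auto
    finally show ?thesis .
  qed
  have K: "?K \<in> carrier_mat (d - 1) d" using M N by auto
  have z_new: "vec_block n j (z m) \<in> cspan n U" if "j \<in> {1..d}" for j
    by (rule blocks_in_cspan_if_delete_col_invertible
        [where y = "\<lambda>j. vec_block n j (z m)", OF U K assms(7,8) _ row zp that]) auto
  \<comment> \<open>Because \<open>h m $ m\<close> is nonzero, \<open>x m\<close> and the old iterates determine \<open>v (m + 1)\<close>, block by block.\<close>
  have v_new: "vec_block n i (v (m + 1)) \<in> cspan n U"
    if i: "i \<in> {1..d}" and xi: "vec_block n i (x m) \<in> cspan n U" for i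
  proof -
    let ?g = "vec n (\<lambda>r. \<Sum>c<m. h m $ c * vec_block n i (v (Suc c)) $ r)"
    have g: "?g \<in> cspan n U"
      using v_old[OF i] by (intro cspan_vec_sum[OF U]) auto
    have hm: "h m $ m \<noteq> 0" "h m \<in> carrier_vec (m + 1)"
      and xm: "x m = iter_mat ?D v (m + 1) *\<^sub>v h m" using step[OF m] by auto
    have "vec_block n i (x m) $ r = ?g $ r + h m $ m * vec_block n i (v (m + 1)) $ r"
      if "r < n" for r
      unfolding xm vec_block_iter_mat_mult[OF i hm(2)] using that by simp
    then have "vec_block n i (v (m + 1)) =
        vec n (\<lambda>r. (1 / h m $ m) * vec_block n i (x m) $ r + (- 1 / h m $ m) * ?g $ r)"
      using hm(1) by (intro eq_vecI) (auto simp: vec_block_def field_simps)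
    then show ?thesis
      using cspan_vec_axpy[OF U xi g, of "1 / h m $ m" "- 1 / h m $ m"] by (simp only:)
  qed
  have xm: "x m = ?BB *\<^sub>v z m" using step[OF m] by auto
  have x_lower: "vec_block n i (x m) \<in> cspan n U" if i: "i \<in> {2..d}" for i
  proof -
    define l where "l = i - 2"
    have l: "i = l + 2" "l < d - 1" using i by (auto simp: l_def)
    have "vec_block n i (x m) = vec n (\<lambda>r. \<Sum>j<d. N $$ (l, j) * vec_block n (Suc j) (z m) $ r)"
      unfolding xm l(1)
    proof (rule eq_vecI)
      fix r assume "r < dim_vec (vec n (\<lambda>r. \<Sum>j<d. N $$ (l, j) * vec_block n (Suc j) (z m) $ r))"
      then have r: "r < n" by simp
      show "vec_block n (l + 2) (?BB *\<^sub>v z m) $ r =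
          vec n (\<lambda>r. \<Sum>j<d. N $$ (l, j) * vec_block n (Suc j) (z m) $ r) $ r"
        unfolding vec_block_pencil_mult_lower[OF B N zm l(2) r] using r by simp
    qed (simp add: vec_block_def)
    also have "\<dots> \<in> cspan n U" by (rule cspan_vec_sum[OF U]) (use z_new in auto)
    finally show ?thesis .
  qed
  \<comment> \<open>The space \<open>R\<close> stays open because both claims use this inclusion: \<open>R\<close> is \<open>U\<close> with \<open>?v1\<close> added, or \<open>U\<close>
    itself if the first block of \<open>v (m + 1)\<close> already lies in its span.\<close>
  have S'_sub: "S' \<subseteq> cspan n R"
    if R: "R \<subseteq> carrier_vec n" "U \<subseteq> R" and first: "?v1 \<in> cspan n R" for R
  proof -
    have UR: "cspan n U \<subseteq> cspan n R" by (rule cspan_mono[OF R])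
    have "vec_block n i (v k) \<in> cspan n R" if ik: "i \<in> {1..d}" "k \<in> {1..m + 1}" for i k
    proof (cases "k = m + 1")
      case True
      show ?thesis
      proof (cases "i = 1")
        case False
        then have "i \<in> {2..d}" using ik by auto
        then show ?thesis using True v_new[OF ik(1) x_lower] UR by blast
      qed (use True first in simp)
    next
      case False
      then have "k - 1 < m" "Suc (k - 1) = k" using ik by auto
      then show ?thesis using v_old[OF ik(1), of "k - 1"] UR by auto
    qed
    moreover have "vec_block n i (z k) \<in> cspan n R" if ik: "i \<in> {1..d}" "k \<in> {1..m}" for i k
    proof (cases "k = m")
      case False
      have "vec_block n i (z k) \<in> {vec_block n i (z k) |i k. i \<in> {1..d} \<and> k \<in> {1..m - 1}}"
        by (intro CollectI exI[of _ i] exI[of _ k]) (use ik False in auto)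
      then have "vec_block n i (z k) \<in> U" unfolding U_def S_def by blast
      then show ?thesis using cspan_superset[OF U] UR by blast
    qed (use z_new[OF ik(1)] UR in auto)
    ultimately show ?thesis unfolding S'_def by auto
  qed
  have U_S': "insert ?v1 U \<subseteq> S'"
  proof -
    have "{1..m} \<subseteq> {1..m + 1}" "{1..m - 1} \<subseteq> {1..m}" "1 \<in> {1..d}" "m + 1 \<in> {1..m + 1}"
      using d by auto
    then show ?thesis using m assms(7) unfolding U_def S_def S'_def by blast
  qed
  have "cspan n S' = cspan n (insert ?v1 U)"
  proof (rule equalityI)
    have R: "insert ?v1 U \<subseteq> carrier_vec n" using U by auto
    show "cspan n S' \<subseteq> cspan n (insert ?v1 U)"
    proof (rule cspan_minimal[OF R S'_sub[OF R]])
      show "?v1 \<in> cspan n (insert ?v1 U)" by (rule cspan_superset[OF R]) simp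
    qed auto
    show "cspan n (insert ?v1 U) \<subseteq> cspan n S'" by (rule cspan_mono[OF S' U_S'])
  qed
  moreover have "cspan n (set (cols Q_m) \<union> {?zp, ?v1}) = cspan n (S \<union> {?zp, ?v1})"
    by (rule cspan_Un_cong[OF span_Q Q S]) auto
  moreover have "S \<union> {?zp, ?v1} = insert ?v1 U" by (auto simp: U_def)
  ultimately have general: "colspan Q_m1 = cspan n (set (cols Q_m) \<union> {?zp, ?v1})"
    using span_Q' by simp

  \<comment> \<open>With scalar blocks \<open>B i\<close> the first block of \<open>x m\<close> combines the blocks of \<open>z m\<close> like the others.\<close>
  have "colspan Q_m1 = cspan n (set (cols Q_m) \<union> {?zp})"
    if c: "c \<in> carrier_vec d" "coeff_row n d B = mat_of_rows d [c] \<otimes>\<^sub>K 1\<^sub>m n" for c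
  proof -
    have "vec_block n 1 (x m) = vec n (\<lambda>r. \<Sum>j<d. c $ j * vec_block n (Suc j) (z m) $ r)"
    proof (rule eq_vecI)
      fix r assume "r < dim_vec (vec n (\<lambda>r. \<Sum>j<d. c $ j * vec_block n (Suc j) (z m) $ r))"
      then have r: "r < n" by simp
      show "vec_block n 1 (x m) $ r = vec n (\<lambda>r. \<Sum>j<d. c $ j * vec_block n (Suc j) (z m) $ r) $ r"
        unfolding xm vec_block_pencil_mult_first[OF B N zm r] c(2)
        using kron_one_mult_vec_index[of 0 "mat_of_rows d [c]" r n "z m"] r zm c(1)
        by (simp add: mat_of_rows_index)
    qed (simp add: vec_block_def)
    also have "\<dots> \<in> cspan n U" by (rule cspan_vec_sum[OF U]) (use z_new in auto)
    finally have "?v1 \<in> cspan n U" using d by (intro v_new) auto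
    then have "cspan n S' \<subseteq> cspan n U" by (intro cspan_minimal[OF U] S'_sub[OF U]) auto
    moreover have "cspan n U \<subseteq> cspan n S'" using U_S' by (intro cspan_mono[OF S']) auto
    moreover have "cspan n (set (cols Q_m) \<union> {?zp}) = cspan n (S \<union> {?zp})"
      by (rule cspan_Un_cong[OF span_Q Q S]) auto
    moreover have "S \<union> {?zp} = U" by (auto simp: U_def)
    ultimately show ?thesis using span_Q' by auto
  qed
  with general show ?thesis by blast
qed

end
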